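(* Let $\Gamma$ be a cofinite graph and let $I$ be a fundamental system of compatible cofinite entourages of $\Gamma$, directed by reverse inclusion ($R\le S$ iff $S\subseteq R$). Then the inverse limit $\widehat\Gamma=\varprojlim_{R\in I}\Gamma/R$ is a compact Hausdorff topological graph, and the natural map $\Gamma\to\widehat\Gamma$, $x\mapsto (R[x])_{R\in I}$, embeds $\Gamma$ as a dense subgraph of $\widehat\Gamma$.
   Context: A graph is a set $\Gamma$ partitioned into subsets $V(\Gamma)$ (vertices) and $E(\Gamma)$ (edges), with maps $s,t\colon E(\Gamma)\to V(\Gamma)$ and $e\mapsto\overline e$, $E(\Gamma)\to E(\Gamma)$, such that $\overline e\ne e$, $\overline{\overline e}=e$, $t(\overline e)=s(e)$, $s(\overline e)=t(e)$ for all edges $e$. A map of graphs sends vertices to vertices and edges to edges and preserves $s$, $t$ and edge inversion. A subgraph is a subset closed under $s$, $t$ and edge inversion, with the restricted structure maps. A topological graph is a graph with a topology such that $V(\Gamma),E(\Gamma)$ are closed, $s,t$ and edge inversion are continuous, and which admits an orientation, i.e. a closed subset $E^+(\Gamma)\subseteq E(\Gamma)$ containing exactly one edge of each pair $\{e,\overline e\}$. An equivalence relation $R$ on a graph $\Gamma$ is compatible if: (1) $R=R_V\cup R_E$, where $R_V,R_E$ are equivalence relations on $V(\Gamma),E(\Gamma)$ (the restrictions of $R$); (2) $(e_1,e_2)\in R$ for edges $e_1,e_2$ implies $(s(e_1),s(e_2)),(t(e_1),t(e_2)),(\overline{e_1},\overline{e_2})\in R$; (3) $(e,\overline e)\notin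 R$ for all $e\in E(\Gamma)$. A cofinite entourage of a uniform space $X$ is an entourage $R$ that is an equivalence relation on $X$ such that the quotient space $X/R$ is a finite discrete space. A cofinite graph is an abstract graph $\Gamma$ endowed with a Hausdorff uniformity such that every entourage of $\Gamma$ contains a compatible cofinite entourage; its topology is the one induced by the uniformity. A fundamental system of compatible cofinite entourages is a set of compatible cofinite entourages such that every entourage contains a member of the set. $R[x]$ is the $R$-class of $x$. For compatible $R$, $\Gamma/R$ has the unique graph structure making $\Gamma\to\Gamma/R$ a map of graphs; for $R\in I$ it is finite and discrete. The bonding maps for $R\le S$ are $\Gamma/S\to\Gamma/R$, $S[x]\mapsto R[x]$. $\widehat\Gamma$ has the inverse limit topology and the unique graph structure for which all projections $\widehat\Gamma\to\Gamma/R$ are maps of graphs (source, target and inversion are computed coordinatewise). "Embeds" is meant as a topological embedding: the natural map is an injective map of graphs that is a homeomorphism onto its image. *)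

theory Defs
  imports "HOL-Analysis.Analysis"
begin

section \<open>Graphs\<close>

text \<open>
  The underlying set of a graph is the union of its vertices and edges. The values of
  \<open>src\<close>, \<open>tgt\<close> and \<open>opp\<close> outside the set of edges are irrelevant.
\<close>

record 'a pregraph =
  verts :: "'a set"
  edges :: "'a set"
  src :: "'a \<Rightarrow> 'a"
  tgt :: "'a \<Rightarrow> 'a"
  opp :: "'a \<Rightarrow> 'a"

definition points :: "'a pregraph \<Rightarrow> 'a set" where
  "points G = verts G \<union> edges G"

definition is_graph :: "'a pregraph \<Rightarrow> bool" where
  "is_graph G \<longleftrightarrow>
     verts G \<inter> edges G = {} \<and>
     src G \<in> edges G \<rightarrow> verts G \<and>
     tgt G \<in> edges G \<rightarrow> verts G \<and>
     opp G \<in> edges G \<rightarrow> edges G \<and>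
     (\<forall>e\<in>edges G. opp G e \<noteq> e \<and> opp G (opp G e) = e \<and>
        tgt G (opp G e) = src G e \<and> src G (opp G e) = tgt G e)"

definition graph_map :: "'a pregraph \<Rightarrow> 'b pregraph \<Rightarrow> ('a \<Rightarrow> 'b) \<Rightarrow> bool" where
  "graph_map G H f \<longleftrightarrow>
     f \<in> verts G \<rightarrow> verts H \<and> f \<in> edges G \<rightarrow> edges H \<and>
     (\<forall>e\<in>edges G. f (src G e) = src H (f e) \<and> f (tgt G e) = tgt H (f e) \<and>
        f (opp G e) = opp H (f e))"

definition subgraph :: "'a set \<Rightarrow> 'a pregraph \<Rightarrow> bool" where
  "subgraph A G \<longleftrightarrow>
     A \<subseteq> points G \<and> (\<forall>e\<in>A \<inter> edges G. src G e \<in> A \<and> tgt G e \<in> A \<and> opp G e \<in> A)"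

definition topological_graph :: "'a pregraph \<Rightarrow> 'a topology \<Rightarrow> bool" where
  "topological_graph G T \<longleftrightarrow>
     is_graph G \<and> topspace T = points G \<and>
     closedin T (verts G) \<and> closedin T (edges G) \<and>
     continuous_map (subtopology T (edges G)) (subtopology T (verts G)) (src G) \<and>
     continuous_map (subtopology T (edges G)) (subtopology T (verts G)) (tgt G) \<and>
     continuous_map (subtopology T (edges G)) (subtopology T (edges G)) (opp G) \<and>
     (\<exists>P. closedin T P \<and> P \<subseteq> edges G \<and> (\<forall>e\<in>edges G. (e \<in> P) \<noteq> (opp G e \<in> P)))"


section \<open>Uniform spaces on a carrier set\<close>

text \<open>
  The library class \<open>uniform_space\<close> makes a whole type into a uniform space. Here a
  uniformity on a set \<open>X\<close> is given by its set of entourages; the lemmas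
  \<open>uniformity_on_uniform_space\<close> and \<open>uniform_topology_uniform_space\<close> relate the two.
\<close>

definition uniformity_on :: "'a set \<Rightarrow> 'a rel set \<Rightarrow> bool" where
  "uniformity_on X \<U> \<longleftrightarrow>
     X \<times> X \<in> \<U> \<and>
     (\<forall>R\<in>\<U>. Id_on X \<subseteq> R \<and> R \<subseteq> X \<times> X) \<and>
     (\<forall>R\<in>\<U>. \<forall>S. R \<subseteq> S \<and> S \<subseteq> X \<times> X \<longrightarrow> S \<in> \<U>) \<and>
     (\<forall>R\<in>\<U>. \<forall>S\<in>\<U>. R \<inter> S \<in> \<U>) \<and>
     (\<forall>R\<in>\<U>. R\<inverse> \<in> \<U>) \<and>
     (\<forall>R\<in>\<U>. \<exists>S\<in>\<U>. S O S \<subseteq> R)"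

definition uniform_topology :: "'a set \<Rightarrow> 'a rel set \<Rightarrow> 'a topology" where
  "uniform_topology X \<U> = topology (\<lambda>A. A \<subseteq> X \<and> (\<forall>x\<in>A. \<exists>R\<in>\<U>. R `` {x} \<subseteq> A))"

lemma uniformity_on_carrier: "uniformity_on X \<U> \<Longrightarrow> X \<times> X \<in> \<U>"
  unfolding uniformity_on_def by (elim conjE)

lemma uniformity_on_Int:
  assumes "uniformity_on X \<U>" "R \<in> \<U>" "S \<in> \<U>"
  shows "R \<inter> S \<in> \<U>"
proof -
  have "\<forall>R\<in>\<U>. \<forall>S\<in>\<U>. R \<inter> S \<in> \<U>"
    using assms(1) unfolding uniformity_on_def by (elim conjE)
  then show ?thesis using assms(2,3) by (blast dest: bspec)
qed

lemma openin_uniform_topology: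
  assumes "uniformity_on X \<U>"
  shows "openin (uniform_topology X \<U>) A \<longleftrightarrow> A \<subseteq> X \<and> (\<forall>x\<in>A. \<exists>R\<in>\<U>. R `` {x} \<subseteq> A)"
proof -
  have "istopology (\<lambda>A. A \<subseteq> X \<and> (\<forall>x\<in>A. \<exists>R\<in>\<U>. R `` {x} \<subseteq> A))"
    unfolding istopology_def
  proof (intro conjI allI impI)
    fix A B
    assume A: "A \<subseteq> X \<and> (\<forall>x\<in>A. \<exists>R\<in>\<U>. R `` {x} \<subseteq> A)"
      and B: "B \<subseteq> X \<and> (\<forall>x\<in>B. \<exists>R\<in>\<U>. R `` {x} \<subseteq> B)"
    show "A \<inter> B \<subseteq> X" using A by blast
    show "\<forall>x\<in>A \<inter> B. \<exists>R\<in>\<U>. R `` {x} \<subseteq> A \<inter> B"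
    proof
      fix x assume x: "x \<in> A \<inter> B"
      obtain R where R: "R \<in> \<U>" "R `` {x} \<subseteq> A" using A x by auto
      obtain S where S: "S \<in> \<U>" "S `` {x} \<subseteq> B" using B x by auto
      show "\<exists>R\<in>\<U>. R `` {x} \<subseteq> A \<inter> B"
      proof
        show "(R \<inter> S) `` {x} \<subseteq> A \<inter> B" using R(2) S(2) by auto
        show "R \<inter> S \<in> \<U>" using assms R(1) S(1) by (rule uniformity_on_Int)
      qed
    qed
  next
    fix \<K>
    assume \<K>: "\<forall>K\<in>\<K>. K \<subseteq> X \<and> (\<forall>x\<in>K. \<exists>R\<in>\<U>. R `` {x} \<subseteq> K)"
    show "\<Union>\<K> \<subseteq> X" using \<K> by blast
    show "\<forall>x\<in>\<Union>\<K>. \<exists>R\<in>\<U>. R `` {x} \<subseteq> \<Union>\<K>"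
    proof
      fix x assume "x \<in> \<Union>\<K>"
      then obtain K where K: "K \<in> \<K>" "x \<in> K" by blast
      have "\<exists>R\<in>\<U>. R `` {x} \<subseteq> K" by (rule bspec[OF conjunct2[OF bspec[OF \<K> K(1)]] K(2)])
      moreover have "K \<subseteq> \<Union>\<K>" using K(1) by auto
      ultimately show "\<exists>R\<in>\<U>. R `` {x} \<subseteq> \<Union>\<K>" by (meson order_trans)
    qed
  qed
  then show ?thesis
    unfolding uniform_topology_def by (simp add: topology_inverse')
qed

lemma topspace_uniform_topology:
  assumes "uniformity_on X \<U>"
  shows "topspace (uniform_topology X \<U>) = X"
proof
  show "topspace (uniform_topology X \<U>) \<subseteq> X"
    using openin_topspace[of "uniform_topology X \<U>"]
    unfolding openin_uniform_topology[OF assms] by simp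
  have "openin (uniform_topology X \<U>) X"
    unfolding openin_uniform_topology[OF assms]
  proof (intro conjI ballI bexI)
    show "X \<times> X \<in> \<U>" using assms by (rule uniformity_on_carrier)
  qed auto
  then show "X \<subseteq> topspace (uniform_topology X \<U>)" by (rule openin_subset)
qed

lemma uniformity_on_uniform_space:
  "uniformity_on (UNIV :: 'a::uniform_space set) {R. eventually (\<lambda>p. p \<in> R) uniformity}"
  (is "uniformity_on _ ?U")
proof -
  have mem: "R \<in> ?U \<longleftrightarrow> eventually (\<lambda>p. p \<in> R) uniformity" for R :: "'a rel" by simp
  have 1: "UNIV \<times> UNIV \<in> ?U" by simp
  have 2: "Id_on UNIV \<subseteq> R \<and> R \<subseteq> UNIV \<times> UNIV" if "R \<in> ?U" for R
    using uniformity_refl[OF that[unfolded mem]] by (auto simp: Id_on_def)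
  have 3: "S \<in> ?U" if "R \<in> ?U" "R \<subseteq> S \<and> S \<subseteq> UNIV \<times> UNIV" for R S
    unfolding mem by (rule eventually_mono[OF that(1)[unfolded mem]]) (use that(2) in blast)
  have 4: "R \<inter> S \<in> ?U" if "R \<in> ?U" "S \<in> ?U" for R S
    using eventually_conj[OF that[unfolded mem]] by simp
  have 5: "R\<inverse> \<in> ?U" if "R \<in> ?U" for R
    using uniformity_sym[OF that[unfolded mem]] by (simp add: converse_unfold case_prod_unfold)
  have 6: "\<exists>S\<in>?U. S O S \<subseteq> R" if R: "R \<in> ?U" for R
  proof -
    obtain D where "eventually D uniformity" "\<And>x y z. D (x, y) \<Longrightarrow> D (y, z) \<Longrightarrow> (x, z) \<in> R"
      by (rule uniformity_transE[OF R[unfolded mem]]) blast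
    then have "Collect D \<in> ?U" "Collect D O Collect D \<subseteq> R" by (simp, blast)
    then show ?thesis by (rule bexI[rotated])
  qed
  show ?thesis
    unfolding uniformity_on_def
  proof (intro conjI)
    show "\<forall>R\<in>?U. Id_on UNIV \<subseteq> R \<and> R \<subseteq> UNIV \<times> UNIV" by (rule ballI) (rule 2)
    show "\<forall>R\<in>?U. \<forall>S. R \<subseteq> S \<and> S \<subseteq> UNIV \<times> UNIV \<longrightarrow> S \<in> ?U"
      by (intro ballI allI impI) (rule 3)
    show "\<forall>R\<in>?U. \<forall>S\<in>?U. R \<inter> S \<in> ?U" by (intro ballI) (rule 4)
    show "\<forall>R\<in>?U. R\<inverse> \<in> ?U" by (rule ballI) (rule 5)
    show "\<forall>R\<in>?U. \<exists>S\<in>?U. S O S \<subseteq> R" by (rule ballI) (rule 6)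
  qed (rule 1)
qed

lemma uniform_topology_uniform_space:
  "uniform_topology (UNIV :: 'a::uniform_space set) {R. eventually (\<lambda>p. p \<in> R) uniformity} = euclidean"
proof (rule topology_eq[THEN iffD2], intro allI)
  fix A :: "'a set"
  have "(\<exists>R\<in>{R. eventually (\<lambda>p. p \<in> R) uniformity}. R `` {x} \<subseteq> A) \<longleftrightarrow>
      (\<forall>\<^sub>F (x', y) in uniformity. x' = x \<longrightarrow> y \<in> A)" (is "?L \<longleftrightarrow> ?R") for x
  proof
    assume ?L
    then obtain R where "eventually (\<lambda>p. p \<in> R) uniformity" "R `` {x} \<subseteq> A" by blast
    then show ?R by (elim eventually_mono) auto
  next
    assume ?R
    then have "eventually (\<lambda>p. p \<in> {(x', y). x' = x \<longrightarrow> y \<in> A}) uniformity"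
      by (rule eventually_mono) simp
    moreover have "{(x', y). x' = x \<longrightarrow> y \<in> A} `` {x} \<subseteq> A" by auto
    ultimately show ?L by (intro bexI CollectI)
  qed
  then show "openin (uniform_topology UNIV {R. eventually (\<lambda>p. p \<in> R) uniformity}) A \<longleftrightarrow>
      openin euclidean A"
    by (simp only: openin_uniform_topology[OF uniformity_on_uniform_space] open_uniformity
        open_openin[symmetric] subset_UNIV simp_thms)
qed


section \<open>Cofinite graphs\<close>

definition compatible :: "'a pregraph \<Rightarrow> 'a rel \<Rightarrow> bool" where
  "compatible G R \<longleftrightarrow>
     equiv (points G) R \<and>
     (let R\<^sub>V = R \<inter> verts G \<times> verts G; R\<^sub>E = R \<inter> edges G \<times> edges G in
        R = R\<^sub>V \<union> R\<^sub>E \<and> equiv (verts G) R\<^sub>V \<and> equiv (edges G) R\<^sub>E) \<and>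
     (\<forall>e\<^sub>1\<in>edges G. \<forall>e\<^sub>2\<in>edges G. (e\<^sub>1, e\<^sub>2) \<in> R \<longrightarrow>
        (src G e\<^sub>1, src G e\<^sub>2) \<in> R \<and> (tgt G e\<^sub>1, tgt G e\<^sub>2) \<in> R \<and> (opp G e\<^sub>1, opp G e\<^sub>2) \<in> R) \<and>
     (\<forall>e\<in>edges G. (e, opp G e) \<notin> R)"

text \<open>
  That the class map is a quotient map onto the discrete space \<open>X // R\<close> says exactly that
  the quotient topology on \<open>X // R\<close> is the discrete one.
\<close>

definition cofinite_entourage :: "'a set \<Rightarrow> 'a rel set \<Rightarrow> 'a rel \<Rightarrow> bool" where
  "cofinite_entourage X \<U> R \<longleftrightarrow>
     R \<in> \<U> \<and> equiv X R \<and> finite (X // R) \<and>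
     quotient_map (uniform_topology X \<U>) (discrete_topology (X // R)) (\<lambda>x. R `` {x})"

definition cofinite_graph :: "'a pregraph \<Rightarrow> 'a rel set \<Rightarrow> bool" where
  "cofinite_graph G \<U> \<longleftrightarrow>
     is_graph G \<and> uniformity_on (points G) \<U> \<and>
     Hausdorff_space (uniform_topology (points G) \<U>) \<and>
     (\<forall>S\<in>\<U>. \<exists>R. compatible G R \<and> cofinite_entourage (points G) \<U> R \<and> R \<subseteq> S)"

definition fundamental_system :: "'a pregraph \<Rightarrow> 'a rel set \<Rightarrow> 'a rel set \<Rightarrow> bool" where
  "fundamental_system G \<U> I \<longleftrightarrow>
     (\<forall>R\<in>I. compatible G R \<and> cofinite_entourage (points G) \<U> R) \<and>
     (\<forall>S\<in>\<U>. \<exists>R\<in>I. R \<subseteq> S)"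

lemma fundamental_system_directed:
  assumes "uniformity_on (points G) \<U>" "fundamental_system G \<U> I"
  shows "I \<noteq> {}" and "\<lbrakk>R \<in> I; S \<in> I\<rbrakk> \<Longrightarrow> \<exists>T\<in>I. T \<subseteq> R \<and> T \<subseteq> S"
proof -
  have ex: "\<exists>R\<in>I. R \<subseteq> S" if "S \<in> \<U>" for S
    using assms(2) that by (simp add: fundamental_system_def)
  have "points G \<times> points G \<in> \<U>" using assms(1) by (rule uniformity_on_carrier)
  from ex[OF this] show "I \<noteq> {}" by (elim bexE) (rule notI, simp)
  assume "R \<in> I" "S \<in> I"
  then have "R \<in> \<U>" "S \<in> \<U>"
    using assms(2) by (simp_all add: fundamental_system_def cofinite_entourage_def)
  with assms(1) have "R \<inter> S \<in> \<U>" by (rule uniformity_on_Int)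
  from ex[OF this] show "\<exists>T\<in>I. T \<subseteq> R \<and> T \<subseteq> S" by (simp only: Int_subset_iff)
qed


section \<open>Quotient graphs\<close>

text \<open>
  For a compatible \<open>R\<close>, the source of the class \<open>R `` {e}\<close> is \<open>R `` {src G e}\<close>, and likewise
  for targets and inverses; see \<open>graph_map_quotient_graph\<close>.
\<close>

definition quotient_graph :: "'a pregraph \<Rightarrow> 'a rel \<Rightarrow> 'a set pregraph" where
  "quotient_graph G R =
     \<lparr>verts = verts G // R, edges = edges G // R,
      src = (\<lambda>c. R `` (src G ` c)), tgt = (\<lambda>c. R `` (tgt G ` c)), opp = (\<lambda>c. R `` (opp G ` c))\<rparr>"

lemma points_quotient_graph: "points (quotient_graph G R) = points G // R"
  by (auto simp: points_def quotient_graph_def quotient_def)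

lemma compatible_Image_image:
  assumes G: "is_graph G" and R: "compatible G R" and e: "e \<in> edges G"
    and f: "\<And>e'. e' \<in> edges G \<Longrightarrow> (e, e') \<in> R \<Longrightarrow> (f e, f e') \<in> R"
  shows "R `` (f ` (R `` {e})) = R `` {f e}"
proof -
  have eq: "equiv (points G) R" and sub: "R \<subseteq> verts G \<times> verts G \<union> edges G \<times> edges G"
    using R unfolding compatible_def Let_def by blast+
  have "verts G \<inter> edges G = {}" using G by (simp add: is_graph_def)
  then have E: "e' \<in> edges G" if "(e, e') \<in> R" for e' using sub e that by blast
  have "R `` {f e'} = R `` {f e}" if "(e, e') \<in> R" for e'
    using f[OF E[OF that] that] equiv_class_eq[OF eq] by blast
  moreover have "(e, e) \<in> R"
    using eq e by (auto simp: equiv_def refl_on_def points_def)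
  ultimately show ?thesis by blast
qed

lemma graph_map_quotient_graph:
  assumes "is_graph G" "compatible G R"
  shows "graph_map G (quotient_graph G R) (\<lambda>x. R `` {x})"
proof -
  have "\<forall>e'\<in>edges G. (e, e') \<in> R \<longrightarrow> (src G e, src G e') \<in> R \<and> (tgt G e, tgt G e') \<in> R \<and>
      (opp G e, opp G e') \<in> R" if "e \<in> edges G" for e
    using assms(2) that unfolding compatible_def by blast
  then show ?thesis
    unfolding graph_map_def quotient_graph_def
    by (auto simp: compatible_Image_image[OF assms] intro: quotientI)
qed

lemma is_graph_quotient_graph:
  assumes G: "is_graph G" and R: "compatible G R"
  shows "is_graph (quotient_graph G R)"
proof -
  let ?Q = "quotient_graph G R"
  let ?q = "\<lambda>x. R `` {x}"
  have map: "?q (src G e) = src ?Q (?q e)" "?q (tgt G e) = tgt ?Q (?q e)"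
    "?q (opp G e) = opp ?Q (?q e)" if "e \<in> edges G" for e
    using graph_map_quotient_graph[OF G R] that by (auto simp: graph_map_def)
  have eq: "equiv (points G) R" and sub: "R \<subseteq> verts G \<times> verts G \<union> edges G \<times> edges G"
    and noinv: "\<forall>e\<in>edges G. (e, opp G e) \<notin> R"
    using R unfolding compatible_def Let_def by blast+
  have disj: "verts G \<inter> edges G = {}" using G by (simp add: is_graph_def)
  have refl: "(x, x) \<in> R" if "x \<in> points G" for x
    using eq that by (auto simp: equiv_def refl_on_def)
  have V: "verts ?Q = ?q ` verts G" and E: "edges ?Q = ?q ` edges G"
    by (auto simp: quotient_graph_def quotient_def)
  have "?q v \<noteq> ?q e" if "v \<in> verts G" "e \<in> edges G" for v e
  proof
    assume "?q v = ?q e"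
    then have "(v, e) \<in> R" using refl[of e] that by (auto simp: points_def)
    then show False using sub disj that by blast
  qed
  then have "verts ?Q \<inter> edges ?Q = {}" unfolding V E by blast
  moreover have "?q (opp G e) \<noteq> ?q e" if "e \<in> edges G" for e
  proof
    assume "?q (opp G e) = ?q e"
    moreover have "opp G e \<in> points G" using G that by (auto simp: points_def is_graph_def)
    ultimately have "(e, opp G e) \<in> R" using refl by auto
    then show False using noinv that by blast
  qed
  ultimately show ?thesis
    using G unfolding is_graph_def V E by (auto simp: map[symmetric] Pi_iff)
qed

lemma bonding_map_class:
  assumes "equiv X R" "equiv X S" "S \<subseteq> R" "x \<in> X"
  shows "R `` (S `` {x}) = R `` {x}"
proof -
  have "(x, x) \<in> S" using assms by (auto simp: equiv_def refl_on_def)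
  moreover have "R `` {y} = R `` {x}" if "(x, y) \<in> S" for y
    using assms that equiv_class_eq[OF assms(1), of x y] by auto
  ultimately show ?thesis by blast
qed


section \<open>Inverse limits\<close>

text \<open>
  Families indexed by \<open>I\<close> are extensional functions on \<open>I\<close>. For \<open>le i j\<close>, the bonding map
  \<open>\<phi> i j\<close> goes from the object at \<open>j\<close> to the object at \<open>i\<close>.
\<close>

definition inverse_limit_set ::
    "'i set \<Rightarrow> ('i \<Rightarrow> 'i \<Rightarrow> bool) \<Rightarrow> ('i \<Rightarrow> 'i \<Rightarrow> 'b \<Rightarrow> 'b) \<Rightarrow> ('i \<Rightarrow> 'b set) \<Rightarrow> ('i \<Rightarrow> 'b) set" where
  "inverse_limit_set I le \<phi> X =
     {x \<in> \<Pi>\<^sub>E i\<in>I. X i. \<forall>i\<in>I. \<forall>j\<in>I. le i j \<longrightarrow> \<phi> i j (x j) = x i}"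

definition inverse_limit_topology ::
    "'i set \<Rightarrow> ('i \<Rightarrow> 'i \<Rightarrow> bool) \<Rightarrow> ('i \<Rightarrow> 'i \<Rightarrow> 'b \<Rightarrow> 'b) \<Rightarrow> ('i \<Rightarrow> 'b topology) \<Rightarrow> ('i \<Rightarrow> 'b) topology"
  where
  "inverse_limit_topology I le \<phi> T =
     subtopology (product_topology T I) (inverse_limit_set I le \<phi> (\<lambda>i. topspace (T i)))"

definition inverse_limit_graph ::
    "'i set \<Rightarrow> ('i \<Rightarrow> 'i \<Rightarrow> bool) \<Rightarrow> ('i \<Rightarrow> 'i \<Rightarrow> 'b \<Rightarrow> 'b) \<Rightarrow> ('i \<Rightarrow> 'b pregraph) \<Rightarrow> ('i \<Rightarrow> 'b) pregraph"
  where
  "inverse_limit_graph I le \<phi> G =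
     \<lparr>verts = inverse_limit_set I le \<phi> (\<lambda>i. verts (G i)),
      edges = inverse_limit_set I le \<phi> (\<lambda>i. edges (G i)),
      src = (\<lambda>x. \<lambda>i\<in>I. src (G i) (x i)),
      tgt = (\<lambda>x. \<lambda>i\<in>I. tgt (G i) (x i)),
      opp = (\<lambda>x. \<lambda>i\<in>I. opp (G i) (x i))\<rparr>"

text \<open>
  The bonding map \<open>S[x] \<mapsto> R[x]\<close> sends a class \<open>c\<close> of \<open>S\<close> to \<open>R `` c\<close>; see \<open>bonding_map_class\<close>.
  The underlying set of \<open>completion_topology\<close> is the limit of all of \<open>points G // R\<close>; that each
  of its elements is a vertex or an edge of \<open>completion_graph\<close> is not built in.
\<close>

definition completion_graph :: "'a pregraph \<Rightarrow> 'a rel set \<Rightarrow> ('a rel \<Rightarrow> 'a set) pregraph" where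
  "completion_graph G I =
     inverse_limit_graph I (\<lambda>R S. S \<subseteq> R) (\<lambda>R S c. R `` c) (quotient_graph G)"

definition completion_topology :: "'a pregraph \<Rightarrow> 'a rel set \<Rightarrow> ('a rel \<Rightarrow> 'a set) topology" where
  "completion_topology G I =
     inverse_limit_topology I (\<lambda>R S. S \<subseteq> R) (\<lambda>R S c. R `` c)
       (\<lambda>R. discrete_topology (points (quotient_graph G R)))"

definition completion_map :: "'a rel set \<Rightarrow> 'a \<Rightarrow> ('a rel \<Rightarrow> 'a set)" where
  "completion_map I x = (\<lambda>R\<in>I. R `` {x})"

end

theory Submission
  imports Defs
begin

text \<open>
  The inverse limit is a closed subset of a product of finite discrete spaces: the bonding
  conditions are equations between continuous functions into Hausdorff spaces. So it is compact
  and Hausdorff (\<open>closedin_inverse_limit_set\<close>, Tychonoff's theorem). Because bonding maps are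
  maps of graphs and the index set is directed, one coordinate of a point decides whether the point
  is a vertex or an edge (\<open>directed_graph_system.limit_points_kind\<close>). Hence vertices, edges,
  and an orientation are all pulled back along a single projection to a discrete graph, where every
  set is closed; that the structure maps are continuous can be checked coordinatewise.

  Directedness also makes the sets of all points that share one given coordinate with a point \<open>y\<close>
  a neighbourhood base at \<open>y\<close> (\<open>directed_graph_system.cylinder_neighbourhood\<close>). Since
  each class \<open>y R\<close> contains a point of the original graph, the natural image meets every such set and
  is dense. On the image, the same sets pull back to the classes \<open>R `` {x}\<close>, which form a
  neighbourhood base at \<open>x\<close> in the original graph because the system of entourages is fundamental.
  So the natural map is open onto its image. It is continuous because each class map is a quotient
  map onto a discrete space, and it is injective because a Hausdorff
  uniformity separates points by entourages.
\<close>

section \<open>Graphs and maps of graphs\<close>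

lemma graph_map_points:
  assumes "graph_map G H f" "x \<in> points G"
  shows "f x \<in> points H"
  using assms by (auto simp: graph_map_def points_def)

lemma subgraph_image_graph_map:
  assumes G: "is_graph G" and H: "is_graph H" and f: "graph_map G H f"
  shows "subgraph (f ` points G) H"
  unfolding subgraph_def
proof (intro conjI ballI)
  show "f ` points G \<subseteq> points H" using graph_map_points[OF f] by blast
  fix e assume "e \<in> f ` points G \<inter> edges H"
  then obtain x where x: "x \<in> points G" "e = f x" "f x \<in> edges H" by blast
  \<comment> \<open>A vertex is mapped to a vertex, so an edge in the image comes from an edge.\<close>
  have "x \<in> edges G"
    using x f H by (auto simp: graph_map_def points_def is_graph_def)
  then have "src H e = f (src G x)" "tgt H e = f (tgt G x)" "opp H e = f (opp G x)"
    using f x(2) by (auto simp: graph_map_def)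
  moreover have "{src G x, tgt G x, opp G x} \<subseteq> points G"
    using G \<open>x \<in> edges G\<close> by (auto simp: is_graph_def points_def)
  ultimately show "src H e \<in> f ` points G" "tgt H e \<in> f ` points G" "opp H e \<in> f ` points G"
    by auto
qed

text \<open>
  Choice depends only on the set \<open>{e, opp G e}\<close>, so it selects the same edge whether it is asked
  about \<open>e\<close> or about \<open>opp G e\<close>.
\<close>

lemma orientation_exists:
  assumes "is_graph G"
  shows "\<exists>P\<subseteq>edges G. \<forall>e\<in>edges G. (e \<in> P) \<noteq> (opp G e \<in> P)"
proof (intro exI conjI ballI)
  let ?c = "\<lambda>e. SOME y. y \<in> {e, opp G e}"
  let ?P = "{e \<in> edges G. ?c e = e}"
  show "?P \<subseteq> edges G" by blast
  fix e assume e: "e \<in> edges G"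
  have opp: "opp G e \<in> edges G" "opp G e \<noteq> e" "opp G (opp G e) = e"
    using assms e by (auto simp: is_graph_def)
  have "?c e \<in> {e, opp G e}" by (rule someI) blast
  moreover have "{opp G e, opp G (opp G e)} = {e, opp G e}" using opp by auto
  then have "?c (opp G e) = ?c e" by (simp only:)
  ultimately show "(e \<in> ?P) \<noteq> (opp G e \<in> ?P)" using e opp(1,2) by fastforce
qed


section \<open>Inverse limits of discrete graphs\<close>

lemma inverse_limit_setD:
  assumes "x \<in> inverse_limit_set I le \<phi> X"
  shows "i \<in> I \<Longrightarrow> x i \<in> X i" and "x \<in> extensional I"
    and "\<lbrakk>i \<in> I; j \<in> I; le i j\<rbrakk> \<Longrightarrow> \<phi> i j (x j) = x i"
  using assms by (auto simp: inverse_limit_set_def PiE_iff)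

lemma topspace_inverse_limit_topology:
  "topspace (inverse_limit_topology I le \<phi> T) = inverse_limit_set I le \<phi> (\<lambda>i. topspace (T i))"
  by (auto simp: inverse_limit_topology_def inverse_limit_set_def)

lemma continuous_map_inverse_limit_projection:
  "i \<in> I \<Longrightarrow> continuous_map (inverse_limit_topology I le \<phi> T) (T i) (\<lambda>x. x i)"
  unfolding inverse_limit_topology_def
  by (intro continuous_map_from_subtopology continuous_map_product_projection)

text \<open>
  For each pair \<open>le i j\<close>, the bonding condition defines the set where two continuous maps into the
  Hausdorff space \<open>T i\<close> agree; the limit is the intersection of these closed sets.
\<close>

lemma closedin_inverse_limit_set:
  assumes Haus: "\<And>i. i \<in> I \<Longrightarrow> Hausdorff_space (T i)"
    and cont: "\<And>i j. \<lbrakk>i \<in> I; j \<in> I; le i j\<rbrakk> \<Longrightarrow> continuous_map (T j) (T i) (\<phi> i j)"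
  shows "closedin (product_topology T I) (inverse_limit_set I le \<phi> (\<lambda>i. topspace (T i)))"
proof -
  let ?P = "product_topology T I"
  let ?C = "\<lambda>(i, j). {x \<in> topspace ?P. \<phi> i j (x j) = x i}"
  let ?K = "{(i, j) \<in> I \<times> I. le i j}"
  have "inverse_limit_set I le \<phi> (\<lambda>i. topspace (T i)) = topspace ?P \<inter> \<Inter> (?C ` ?K)"
    by (auto simp: inverse_limit_set_def)
  also have "closedin ?P \<dots>"
  proof (cases "?K = {}")
    case False
    have "closedin ?P (?C k)" if k: "k \<in> ?K" for k
    proof -
      obtain i j where ij: "k = (i, j)" "i \<in> I" "j \<in> I" "le i j" using k by blast
      have "continuous_map ?P (T i) (\<lambda>x. \<phi> i j (x j))"
        using continuous_map_compose[OF continuous_map_product_projection[where X = T, OF ij(3)]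
            cont[OF ij(2-4)]]
        by (simp add: o_def)
      from closedin_continuous_maps_eq[OF Haus[OF ij(2)] this
          continuous_map_product_projection[OF ij(2)]]
      show ?thesis by (simp add: ij(1))
    qed
    with False show ?thesis by (intro closedin_Int closedin_topspace closedin_Inter) auto
  next
    case True
    \<comment> \<open>With no bonding conditions the intersection is \<open>UNIV\<close>, and the limit is the product.\<close>
    then show ?thesis by (simp only: image_empty Inter_empty Int_UNIV_right closedin_topspace)
  qed
  finally show ?thesis .
qed

lemma Hausdorff_space_inverse_limit_topology:
  "(\<And>i. i \<in> I \<Longrightarrow> Hausdorff_space (T i)) \<Longrightarrow> Hausdorff_space (inverse_limit_topology I le \<phi> T)"
  unfolding inverse_limit_topology_def
  by (intro Hausdorff_space_subtopology) (simp add: Hausdorff_space_product_topology)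

lemma compact_space_inverse_limit_topology:
  assumes "\<And>i. i \<in> I \<Longrightarrow> Hausdorff_space (T i)" "\<And>i. i \<in> I \<Longrightarrow> compact_space (T i)"
    and "\<And>i j. \<lbrakk>i \<in> I; j \<in> I; le i j\<rbrakk> \<Longrightarrow> continuous_map (T j) (T i) (\<phi> i j)"
  shows "compact_space (inverse_limit_topology I le \<phi> T)"
  unfolding inverse_limit_topology_def
proof (intro compact_space_subtopology closedin_compact_space)
  show "compact_space (product_topology T I)"
    using assms(2) by (simp add: compact_space_product_topology)
qed (intro closedin_inverse_limit_set assms)

locale directed_graph_system =
  fixes I :: "'i set" and le :: "'i \<Rightarrow> 'i \<Rightarrow> bool"
    and \<phi> :: "'i \<Rightarrow> 'i \<Rightarrow> 'b \<Rightarrow> 'b" and G :: "'i \<Rightarrow> 'b pregraph"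
  assumes nonempty: "I \<noteq> {}"
    and directed: "\<lbrakk>i \<in> I; j \<in> I\<rbrakk> \<Longrightarrow> \<exists>k\<in>I. le i k \<and> le j k"
    and graph: "i \<in> I \<Longrightarrow> is_graph (G i)"
    and bonding: "\<lbrakk>i \<in> I; j \<in> I; le i j\<rbrakk> \<Longrightarrow> graph_map (G j) (G i) (\<phi> i j)"
begin

abbreviation "L \<equiv> inverse_limit_graph I le \<phi> G"
abbreviation "T \<equiv> inverse_limit_topology I le \<phi> (\<lambda>i. discrete_topology (points (G i)))"
abbreviation "limit_points \<equiv> inverse_limit_set I le \<phi> (\<lambda>i. points (G i))"

lemma topspace_T: "topspace T = limit_points"
  by (simp add: topspace_inverse_limit_topology)

lemma verts_L: "verts L = inverse_limit_set I le \<phi> (\<lambda>i. verts (G i))"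
  and edges_L: "edges L = inverse_limit_set I le \<phi> (\<lambda>i. edges (G i))"
  by (simp_all add: inverse_limit_graph_def)

text \<open>
  Two coordinates \<open>x i\<close> and \<open>x j\<close> are images of a common \<open>x k\<close> under bonding maps, which keep
  vertices and edges apart; so they are both vertices or both edges.
\<close>

lemma limit_points_kind:
  assumes x: "x \<in> limit_points" and i: "i \<in> I"
  shows "x \<in> verts L \<longleftrightarrow> x i \<in> verts (G i)" and "x \<in> edges L \<longleftrightarrow> x i \<in> edges (G i)"
proof -
  have kind: "(x i \<in> verts (G i) \<longrightarrow> x j \<in> verts (G j)) \<and> (x i \<in> edges (G i) \<longrightarrow> x j \<in> edges (G j))"
    if j: "j \<in> I" for j
  proof -
    obtain k where k: "k \<in> I" "le i k" "le j k" using directed[OF i j] by blast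
    have "x k \<in> verts (G k) \<or> x k \<in> edges (G k)"
      using inverse_limit_setD(1)[OF x k(1)] by (simp add: points_def)
    moreover have "\<phi> i k (x k) = x i" "\<phi> j k (x k) = x j"
      using inverse_limit_setD(3)[OF x] i j k by auto
    moreover have "verts (G i) \<inter> edges (G i) = {}" using graph[OF i] by (simp add: is_graph_def)
    moreover have "\<phi> i k \<in> verts (G k) \<rightarrow> verts (G i)" "\<phi> i k \<in> edges (G k) \<rightarrow> edges (G i)"
      "\<phi> j k \<in> verts (G k) \<rightarrow> verts (G j)" "\<phi> j k \<in> edges (G k) \<rightarrow> edges (G j)"
      using bonding[OF i k(1,2)] bonding[OF j k(1,3)] by (auto simp: graph_map_def)
    ultimately show ?thesis by (metis PiE disjoint_iff)
  qed
  show "x \<in> verts L \<longleftrightarrow> x i \<in> verts (G i)" "x \<in> edges L \<longleftrightarrow> x i \<in> edges (G i)"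
    using kind i x unfolding verts_L edges_L inverse_limit_set_def by (auto simp: PiE_iff)
qed

lemma points_L: "points L = limit_points"
proof
  show "points L \<subseteq> limit_points"
    by (auto simp: points_def verts_L edges_L inverse_limit_set_def PiE_iff)
  obtain i where i: "i \<in> I" using nonempty by blast
  show "limit_points \<subseteq> points L"
    using limit_points_kind[OF _ i] inverse_limit_setD(1)[OF _ i] by (fastforce simp: points_def)
qed

lemma structure_maps_L:
  assumes e: "e \<in> edges L"
  shows "src L e \<in> verts L" "tgt L e \<in> verts L" "opp L e \<in> edges L"
  using e bonding graph unfolding verts_L edges_L
  by (auto simp: inverse_limit_graph_def inverse_limit_set_def PiE_iff graph_map_def is_graph_def
      Pi_iff)

lemma is_graph_L: "is_graph L"
proof -
  obtain i where i: "i \<in> I" using nonempty by blast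
  have disj: "verts (G i) \<inter> edges (G i) = {}" using graph[OF i] by (simp add: is_graph_def)
  have "verts L \<inter> edges L = {}"
    using disj i inverse_limit_setD(1)[OF _ i] unfolding verts_L edges_L by blast
  moreover have "opp L e \<noteq> e \<and> opp L (opp L e) = e \<and> tgt L (opp L e) = src L e \<and>
      src L (opp L e) = tgt L e" if e: "e \<in> edges L" for e
  proof -
    have coord: "e j \<in> edges (G j)" if "j \<in> I" for j
      using inverse_limit_setD(1)[OF e[unfolded edges_L] that] .
    have rules: "opp (G j) (e j) \<noteq> e j" "opp (G j) (opp (G j) (e j)) = e j"
      "tgt (G j) (opp (G j) (e j)) = src (G j) (e j)"
      "src (G j) (opp (G j) (e j)) = tgt (G j) (e j)" if "j \<in> I" for j
      using graph[OF that] coord[OF that] by (auto simp: is_graph_def)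
    have "opp L e i \<noteq> e i" using rules(1)[OF i] i by (simp add: inverse_limit_graph_def)
    then have "opp L e \<noteq> e" by metis
    moreover have "opp L (opp L e) = e"
    proof (rule extensionalityI[where A = I])
      show "e \<in> extensional I" by (rule inverse_limit_setD(2)[OF e[unfolded edges_L]])
    qed (simp_all add: inverse_limit_graph_def rules(2))
    moreover have "tgt L (opp L e) = src L e" "src L (opp L e) = tgt L e"
      using rules(3,4) by (auto simp: inverse_limit_graph_def)
    ultimately show ?thesis by blast
  qed
  ultimately show ?thesis
    using structure_maps_L unfolding is_graph_def by blast
qed

lemma clopen_preimage_projection:
  assumes "i \<in> I"
  shows "closedin T {x \<in> limit_points. x i \<in> A}" "openin T {x \<in> limit_points. x i \<in> A}"
proof -
  have eq: "{x \<in> limit_points. x i \<in> A} = {x \<in> topspace T. x i \<in> A \<inter> points (G i)}"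
    using inverse_limit_setD(1)[OF _ assms] by (auto simp: topspace_T)
  have proj: "continuous_map T (discrete_topology (points (G i))) (\<lambda>x. x i)"
    by (rule continuous_map_inverse_limit_projection[OF assms])
  show "closedin T {x \<in> limit_points. x i \<in> A}"
    unfolding eq by (rule closedin_continuous_map_preimage[OF proj]) auto
  show "openin T {x \<in> limit_points. x i \<in> A}"
    unfolding eq by (rule openin_continuous_map_preimage[OF proj]) auto
qed

text \<open>
  Source, target and inversion all act coordinatewise, so one argument serves the three of them:
  each coordinate of the image depends only on one coordinate of the argument, which ranges over a
  discrete space. Taking \<open>A\<close> to be the vertices or the edges restricts the codomain.
\<close>

lemma continuous_map_coordinatewise:
  assumes f: "\<And>i. i \<in> I \<Longrightarrow> f i \<in> edges (G i) \<rightarrow> points (G i)"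
    and F: "\<And>x. x \<in> edges L \<Longrightarrow> (\<lambda>i\<in>I. f i (x i)) \<in> A" and A: "A \<subseteq> limit_points"
  shows "continuous_map (subtopology T (edges L)) (subtopology T A) (\<lambda>x. \<lambda>i\<in>I. f i (x i))"
proof -
  let ?D = "\<lambda>i. discrete_topology (points (G i))"
  have "continuous_map (subtopology T (edges L)) (product_topology ?D I) (\<lambda>x. \<lambda>i\<in>I. f i (x i))"
  proof (rule continuous_map_coordinatewise_then_product)
    fix i assume i: "i \<in> I"
    have "continuous_map (subtopology T (edges L)) (subtopology (?D i) (edges (G i))) (\<lambda>x. x i)"
      using i inverse_limit_setD(1)[OF _ i]
      by (intro continuous_map_into_subtopology continuous_map_from_subtopology
          continuous_map_inverse_limit_projection) (auto simp: edges_L)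
    moreover have "continuous_map (subtopology (?D i) (edges (G i))) (?D i) (f i)"
      using f[OF i] by auto
    ultimately have "continuous_map (subtopology T (edges L)) (?D i) (f i \<circ> (\<lambda>x. x i))"
      by (rule continuous_map_compose)
    then show "continuous_map (subtopology T (edges L)) (?D i) (\<lambda>x. (\<lambda>i\<in>I. f i (x i)) i)"
      using i by (simp add: o_def)
  qed simp
  then show ?thesis
    using F A by (auto simp: inverse_limit_topology_def continuous_map_in_subtopology)
qed

lemma topological_graph_L: "topological_graph L T"
proof -
  obtain i where i: "i \<in> I" using nonempty by blast
  have sub: "verts L \<subseteq> limit_points" "edges L \<subseteq> limit_points"
    using points_L by (auto simp: points_def)
  have "verts L = {x \<in> limit_points. x i \<in> verts (G i)}"
    using limit_points_kind(1)[OF _ i] sub(1) by blast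
  then have closed_verts: "closedin T (verts L)"
    by (simp only: clopen_preimage_projection(1)[OF i])
  have edges_eq: "edges L = {x \<in> limit_points. x i \<in> edges (G i)}"
    using limit_points_kind(2)[OF _ i] sub(2) by blast
  then have closed_edges: "closedin T (edges L)"
    by (simp only: clopen_preimage_projection(1)[OF i])
  have L_maps: "src L = (\<lambda>x. \<lambda>j\<in>I. src (G j) (x j))" "tgt L = (\<lambda>x. \<lambda>j\<in>I. tgt (G j) (x j))"
    "opp L = (\<lambda>x. \<lambda>j\<in>I. opp (G j) (x j))"
    by (simp_all add: inverse_limit_graph_def)
  have G_maps: "src (G j) \<in> edges (G j) \<rightarrow> points (G j)" "tgt (G j) \<in> edges (G j) \<rightarrow> points (G j)"
    "opp (G j) \<in> edges (G j) \<rightarrow> points (G j)" if "j \<in> I" for j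
    using graph[OF that] by (auto simp: is_graph_def points_def)
  have cont: "continuous_map (subtopology T (edges L)) (subtopology T (verts L)) (src L)"
    "continuous_map (subtopology T (edges L)) (subtopology T (verts L)) (tgt L)"
    "continuous_map (subtopology T (edges L)) (subtopology T (edges L)) (opp L)"
    using structure_maps_L G_maps sub unfolding L_maps
    by (intro continuous_map_coordinatewise; blast)+
  \<comment> \<open>An orientation of the single discrete graph \<open>G i\<close> pulls back to one of the limit.\<close>
  obtain P where P: "P \<subseteq> edges (G i)" "\<forall>e\<in>edges (G i). (e \<in> P) \<noteq> (opp (G i) e \<in> P)"
    using orientation_exists[OF graph[OF i]] by blast
  let ?P = "{x \<in> limit_points. x i \<in> P}"
  have "?P \<subseteq> edges L" using P(1) edges_eq by blast
  moreover have "(e \<in> ?P) \<noteq> (opp L e \<in> ?P)" if e: "e \<in> edges L" for e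
  proof -
    have "opp L e i = opp (G i) (e i)" using i by (simp add: L_maps)
    moreover have "e \<in> limit_points" "opp L e \<in> limit_points" "e i \<in> edges (G i)"
      using e structure_maps_L(3)[OF e] edges_eq by auto
    ultimately show ?thesis using P(2) by simp
  qed
  ultimately have "\<exists>P. closedin T P \<and> P \<subseteq> edges L \<and> (\<forall>e\<in>edges L. (e \<in> P) \<noteq> (opp L e \<in> P))"
    using clopen_preimage_projection(1)[OF i, of P] by blast
  then show ?thesis
    using is_graph_L closed_verts closed_edges cont
    unfolding topological_graph_def topspace_T points_L by blast
qed

lemma compact_space_T:
  assumes "\<And>i. i \<in> I \<Longrightarrow> finite (points (G i))"
  shows "compact_space T"
  using assms graph_map_points[OF bonding]
  by (intro compact_space_inverse_limit_topology) (auto simp: compact_space_discrete_topology)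

lemma Hausdorff_space_T: "Hausdorff_space T"
  by (simp add: Hausdorff_space_inverse_limit_topology)

text \<open>
  A basic open set of the product constrains finitely many coordinates. By directedness all of them
  are determined by a single coordinate further along the system.
\<close>

lemma coordinate_determines_finitely_many:
  assumes y: "y \<in> limit_points" and F: "finite F" "F \<subseteq> I"
  shows "\<exists>k\<in>I. \<forall>z\<in>limit_points. z k = y k \<longrightarrow> (\<forall>i\<in>F. z i = y i)"
  using F
proof (induction F rule: finite_induct)
  case empty
  then show ?case using nonempty by auto
next
  case (insert j F)
  then obtain k where k: "k \<in> I" "\<forall>z\<in>limit_points. z k = y k \<longrightarrow> (\<forall>i\<in>F. z i = y i)" by auto
  obtain l where l: "l \<in> I" "le j l" "le k l" using directed[of j k] insert.prems k(1) by blast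
  have "z j = y j \<and> z k = y k" if "z \<in> limit_points" "z l = y l" for z
    using inverse_limit_setD(3)[OF that(1)] inverse_limit_setD(3)[OF y] that(2) l k(1) insert.prems
    by (metis insert_subset)
  then show ?case using l(1) k(2) by blast
qed

lemma cylinder_neighbourhood:
  assumes W: "openin T W" and y: "y \<in> W"
  shows "\<exists>k\<in>I. {z \<in> limit_points. z k = y k} \<subseteq> W"
proof -
  let ?D = "\<lambda>i. discrete_topology (points (G i))"
  obtain V where V: "openin (product_topology ?D I) V" "W = V \<inter> limit_points"
    using W by (auto simp: inverse_limit_topology_def openin_subtopology)
  obtain U where U: "finite {i \<in> I. U i \<noteq> topspace (?D i)}" "y \<in> Pi\<^sub>E I U" "Pi\<^sub>E I U \<subseteq> V"
    using V y unfolding openin_product_topology_alt by blast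
  have "y \<in> limit_points" using V(2) y by blast
  from coordinate_determines_finitely_many[OF this U(1)] obtain k where
    k: "k \<in> I" "\<forall>z\<in>limit_points. z k = y k \<longrightarrow> (\<forall>i\<in>{i \<in> I. U i \<noteq> topspace (?D i)}. z i = y i)"
    by auto
  have "z \<in> Pi\<^sub>E I U" if z: "z \<in> limit_points" "z k = y k" for z
  proof (rule PiE_I)
    fix i assume i: "i \<in> I"
    show "z i \<in> U i"
    proof (cases "U i = topspace (?D i)")
      case True
      then show ?thesis using inverse_limit_setD(1)[OF z(1) i] by simp
    next
      case False
      then have "z i = y i" using k(2) z i by blast
      then show ?thesis using PiE_mem[OF U(2) i] by (simp only:)
    qed
  next
    fix i assume "i \<notin> I"
    then show "z i = undefined" by (rule extensional_arb[OF inverse_limit_setD(2)[OF z(1)]])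
  qed
  then have "{z \<in> limit_points. z k = y k} \<subseteq> W" using U(3) V(2) by blast
  with k(1) show ?thesis by (rule bexI[rotated])
qed

lemma dense_if_meets_coordinates:
  assumes "\<And>y i. \<lbrakk>y \<in> limit_points; i \<in> I\<rbrakk> \<Longrightarrow> \<exists>a\<in>A \<inter> limit_points. a i = y i"
  shows "T closure_of A = topspace T"
  unfolding dense_intersects_open
proof (intro allI impI)
  fix W assume W: "openin T W \<and> W \<noteq> {}"
  then obtain y where y: "y \<in> W" by blast
  then have "y \<in> limit_points" using openin_subset[of T W] W topspace_T by blast
  then show "A \<inter> W \<noteq> {}"
    using cylinder_neighbourhood[of W y] W y assms[of y] by blast
qed

end


section \<open>The completion of a cofinite graph\<close>

lemma compatible_equiv: "compatible G R \<Longrightarrow> equiv (points G) R"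
  by (simp add: compatible_def)

text \<open>
  The quotient map onto \<open>quotient_graph G S\<close> is surjective, and following it by the bonding map gives
  the quotient map onto \<open>quotient_graph G R\<close>. Both quotient maps preserve the graph structure, and
  this forces the bonding map to preserve it.
\<close>

lemma graph_map_bonding:
  assumes G: "is_graph G" and R: "compatible G R" and S: "compatible G S" and le: "S \<subseteq> R"
  shows "graph_map (quotient_graph G S) (quotient_graph G R) (\<lambda>c. R `` c)"
proof -
  let ?QR = "quotient_graph G R" and ?QS = "quotient_graph G S"
  have cls: "R `` (S `` {x}) = R `` {x}" if "x \<in> points G" for x
    using bonding_map_class[OF compatible_equiv[OF R] compatible_equiv[OF S] le that] .
  have pts: "src G e \<in> points G" "tgt G e \<in> points G" "opp G e \<in> points G" "e \<in> points G"
    if "e \<in> edges G" for e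
    using G that by (auto simp: is_graph_def points_def)
  have qR: "graph_map G ?QR (\<lambda>x. R `` {x})" and qS: "graph_map G ?QS (\<lambda>x. S `` {x})"
    using graph_map_quotient_graph[OF G] R S by auto
  have maps: "R `` src ?QS c = src ?QR (R `` c) \<and> R `` tgt ?QS c = tgt ?QR (R `` c) \<and>
      R `` opp ?QS c = opp ?QR (R `` c)" if "c \<in> edges ?QS" for c
  proof -
    obtain e where e: "e \<in> edges G" "c = S `` {e}"
      using \<open>c \<in> edges ?QS\<close> by (auto simp: quotient_graph_def elim: quotientE)
    show ?thesis
      using qR qS e pts[OF e(1)] by (simp add: graph_map_def cls flip: e(2)) (metis cls e(2))
  qed
  have "R `` c \<in> A // R" if A: "A \<subseteq> points G" and c: "c \<in> A // S" for A c
  proof -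
    obtain x where x: "x \<in> A" "c = S `` {x}" using c by (rule quotientE)
    then have "R `` c = R `` {x}" using A cls[of x] by blast
    then show ?thesis using x(1) by (simp add: quotientI)
  qed
  then show ?thesis
    using maps unfolding graph_map_def
    by (auto simp: quotient_graph_def points_def)
qed

lemma uniform_topology_separating_entourage:
  assumes U: "uniformity_on X \<U>" and "Hausdorff_space (uniform_topology X \<U>)"
    and "x \<in> X" "y \<in> X" "x \<noteq> y"
  shows "\<exists>R\<in>\<U>. (x, y) \<notin> R"
proof -
  obtain A B where "openin (uniform_topology X \<U>) A" "x \<in> A" "y \<in> B" "disjnt A B"
    using assms(2-5) unfolding Hausdorff_space_def topspace_uniform_topology[OF U] by blast
  then show ?thesis unfolding openin_uniform_topology[OF U] disjnt_iff by blast
qed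

locale cofinite_graph_system =
  fixes \<Gamma> :: "'a pregraph" and \<U> I :: "'a rel set"
  assumes cofinite: "cofinite_graph \<Gamma> \<U>" and fundamental: "fundamental_system \<Gamma> \<U> I"
begin

lemma graph_\<Gamma>: "is_graph \<Gamma>"
  and uniformity: "uniformity_on (points \<Gamma>) \<U>"
  and Hausdorff: "Hausdorff_space (uniform_topology (points \<Gamma>) \<U>)"
  using cofinite by (auto simp: cofinite_graph_def)

lemma compatible_I: "R \<in> I \<Longrightarrow> compatible \<Gamma> R"
  and cofinite_I: "R \<in> I \<Longrightarrow> cofinite_entourage (points \<Gamma>) \<U> R"
  and cofinal: "S \<in> \<U> \<Longrightarrow> \<exists>R\<in>I. R \<subseteq> S"
  using fundamental by (auto simp: fundamental_system_def)

lemma self_in_class: "\<lbrakk>R \<in> I; x \<in> points \<Gamma>\<rbrakk> \<Longrightarrow> x \<in> R `` {x}"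
  using equiv_class_self[OF compatible_equiv[OF compatible_I]] .

sublocale directed_graph_system I "\<lambda>R S. S \<subseteq> R" "\<lambda>R S c. R `` c" "quotient_graph \<Gamma>"
  rewrites "inverse_limit_graph I (\<lambda>R S. S \<subseteq> R) (\<lambda>R S c. R `` c) (quotient_graph \<Gamma>)
      = completion_graph \<Gamma> I"
    and "inverse_limit_topology I (\<lambda>R S. S \<subseteq> R) (\<lambda>R S c. R `` c)
        (\<lambda>R. discrete_topology (points (quotient_graph \<Gamma> R))) = completion_topology \<Gamma> I"
proof -
  show "directed_graph_system I (\<lambda>R S. S \<subseteq> R) (\<lambda>R S c. R `` c) (quotient_graph \<Gamma>)"
    using fundamental_system_directed[OF uniformity fundamental]
    by unfold_locales
      (auto intro: is_graph_quotient_graph graph_map_bonding graph_\<Gamma> compatible_I)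
qed (simp_all add: completion_graph_def completion_topology_def)

lemma completion_map_limit_points:
  assumes "x \<in> points \<Gamma>"
  shows "completion_map I x \<in> limit_points"
  using assms bonding_map_class[OF compatible_equiv[OF compatible_I] compatible_equiv[OF compatible_I]]
  by (auto simp: inverse_limit_set_def completion_map_def points_quotient_graph quotientI)

lemma graph_map_completion_map: "graph_map \<Gamma> (completion_graph \<Gamma> I) (completion_map I)"
proof -
  have q: "graph_map \<Gamma> (quotient_graph \<Gamma> R) (\<lambda>x. R `` {x})" if "R \<in> I" for R
    using graph_map_quotient_graph[OF graph_\<Gamma> compatible_I[OF that]] .
  obtain R where R: "R \<in> I" using nonempty by blast
  have lim: "completion_map I x \<in> limit_points" if "x \<in> verts \<Gamma> \<union> edges \<Gamma>" for x
    using completion_map_limit_points that by (simp add: points_def)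
  have "completion_map I x \<in> verts (completion_graph \<Gamma> I)" if "x \<in> verts \<Gamma>" for x
    using limit_points_kind(1)[OF lim R] q[OF R] R that
    by (auto simp: graph_map_def completion_map_def)
  moreover have "completion_map I x \<in> edges (completion_graph \<Gamma> I)" if "x \<in> edges \<Gamma>" for x
    using limit_points_kind(2)[OF lim R] q[OF R] R that
    by (auto simp: graph_map_def completion_map_def)
  ultimately show ?thesis
    using q by (simp add: graph_map_def completion_graph_def inverse_limit_graph_def
        completion_map_def cong: restrict_cong)
qed

lemma inj_on_completion_map: "inj_on (completion_map I) (points \<Gamma>)"
proof (rule inj_onI, rule ccontr)
  fix x y assume x: "x \<in> points \<Gamma>" and y: "y \<in> points \<Gamma>"
    and eq: "completion_map I x = completion_map I y" and "x \<noteq> y"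
  then obtain S where "S \<in> \<U>" "(x, y) \<notin> S"
    using uniform_topology_separating_entourage[OF uniformity Hausdorff] by blast
  then obtain R where R: "R \<in> I" "(x, y) \<notin> R" using cofinal by blast
  have "R `` {x} = R `` {y}" using fun_cong[OF eq, of R] R(1) by (simp add: completion_map_def)
  then show False using self_in_class[OF R(1) y] R(2) by blast
qed

lemma continuous_map_completion_map:
  "continuous_map (uniform_topology (points \<Gamma>) \<U>) (completion_topology \<Gamma> I) (completion_map I)"
proof -
  have "continuous_map (uniform_topology (points \<Gamma>) \<U>)
      (product_topology (\<lambda>R. discrete_topology (points (quotient_graph \<Gamma> R))) I) (completion_map I)"
  proof (rule continuous_map_coordinatewise_then_product)
    fix R assume R: "R \<in> I"
    have "continuous_map (uniform_topology (points \<Gamma>) \<U>) (discrete_topology (points \<Gamma> // R))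
        (\<lambda>x. R `` {x})"
      using cofinite_I[OF R] by (auto simp: cofinite_entourage_def intro: quotient_imp_continuous_map)
    then show "continuous_map (uniform_topology (points \<Gamma>) \<U>)
        (discrete_topology (points (quotient_graph \<Gamma> R))) (\<lambda>x. completion_map I x R)"
      using R by (simp add: completion_map_def points_quotient_graph)
  qed (simp add: completion_map_def)
  then show ?thesis
    using completion_map_limit_points topspace_uniform_topology[OF uniformity]
    by (auto simp: completion_topology_def inverse_limit_topology_def continuous_map_in_subtopology)
qed

lemma embedding_map_completion_map:
  "embedding_map (uniform_topology (points \<Gamma>) \<U>) (completion_topology \<Gamma> I) (completion_map I)"
proof -
  let ?X = "uniform_topology (points \<Gamma>) \<U>" and ?f = "completion_map I"
  let ?Y = "subtopology (completion_topology \<Gamma> I) (?f ` points \<Gamma>)"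
  have X: "topspace ?X = points \<Gamma>" by (rule topspace_uniform_topology[OF uniformity])
  have image: "?f ` points \<Gamma> \<subseteq> topspace (completion_topology \<Gamma> I)"
    using completion_map_limit_points topspace_T by blast
  have "open_map ?X ?Y ?f"
    unfolding open_map_def
  proof (intro allI impI)
    fix A assume "openin ?X A"
    then have A: "A \<subseteq> points \<Gamma>" "\<forall>x\<in>A. \<exists>S\<in>\<U>. S `` {x} \<subseteq> A"
      unfolding openin_uniform_topology[OF uniformity] by blast+
    show "openin ?Y (?f ` A)"
    proof (subst openin_subopen, intro ballI)
      fix y assume "y \<in> ?f ` A"
      then obtain x where x: "x \<in> A" "y = ?f x" by blast
      then obtain S where "S \<in> \<U>" "S `` {x} \<subseteq> A" using A(2) by blast
      then obtain R where R: "R \<in> I" "R `` {x} \<subseteq> A" using cofinal by blast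
      \<comment> \<open>The trace on the image of the set of limit points with coordinate \<open>R `` {x}\<close>
        at \<open>R\<close> is the image of that class.\<close>
      let ?V = "{z \<in> limit_points. z R \<in> {R `` {x}}} \<inter> ?f ` points \<Gamma>"
      have "openin ?Y ?V"
        unfolding openin_subtopology
        using clopen_preimage_projection(2)[OF R(1), of "{R `` {x}}"] by blast
      moreover have "y \<in> ?V"
        using x A(1) R(1) completion_map_limit_points by (auto simp: completion_map_def)
      moreover have "?V \<subseteq> ?f ` A"
      proof
        fix z assume "z \<in> ?V"
        then obtain w where w: "w \<in> points \<Gamma>" "z = ?f w" "z R = R `` {x}" by blast
        then have "w \<in> A"
          using self_in_class[OF R(1) w(1)] R by (simp add: completion_map_def subset_iff)
        then show "z \<in> ?f ` A" using w(2) by blast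
      qed
      ultimately show "\<exists>V. openin ?Y V \<and> y \<in> V \<and> V \<subseteq> ?f ` A" by blast
    qed
  qed
  moreover have "continuous_map ?X ?Y ?f"
    using continuous_map_completion_map by (simp add: continuous_map_in_subtopology X)
  moreover have "?f ` topspace ?X = topspace ?Y"
    using image by (simp add: X Int_absorb1)
  moreover have "inj_on ?f (topspace ?X)"
    using inj_on_completion_map by (simp add: X)
  ultimately have "homeomorphic_map ?X ?Y ?f"
    by (intro bijective_open_imp_homeomorphic_map)
  then show ?thesis by (simp only: embedding_map_def X)
qed

lemma closure_of_completion_map_image:
  "completion_topology \<Gamma> I closure_of (completion_map I ` points \<Gamma>)
    = points (completion_graph \<Gamma> I)"
  unfolding points_L topspace_T[symmetric]
proof (rule dense_if_meets_coordinates)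
  fix y R assume y: "y \<in> limit_points" and R: "R \<in> I"
  have "y R \<in> points \<Gamma> // R"
    using inverse_limit_setD(1)[OF y R] by (simp add: points_quotient_graph)
  then obtain x where x: "x \<in> points \<Gamma>" "y R = R `` {x}" by (rule quotientE)
  show "\<exists>a\<in>completion_map I ` points \<Gamma> \<inter> limit_points. a R = y R"
  proof
    show "completion_map I x R = y R" using R x(2) by (simp add: completion_map_def)
    show "completion_map I x \<in> completion_map I ` points \<Gamma> \<inter> limit_points"
      using x(1) completion_map_limit_points by blast
  qed
qed

lemma finite_points_quotient_graph: "R \<in> I \<Longrightarrow> finite (points (quotient_graph \<Gamma> R))"
  using cofinite_I by (simp add: points_quotient_graph cofinite_entourage_def)

end

theorem theorem7p5:
  fixes \<Gamma> :: "'a pregraph" and \<U> I :: "'a rel set"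
  assumes "cofinite_graph \<Gamma> \<U>"
    and "fundamental_system \<Gamma> \<U> I"
  shows "topological_graph (completion_graph \<Gamma> I) (completion_topology \<Gamma> I) \<and>
    compact_space (completion_topology \<Gamma> I) \<and>
    Hausdorff_space (completion_topology \<Gamma> I) \<and>
    graph_map \<Gamma> (completion_graph \<Gamma> I) (completion_map I) \<and>
    inj_on (completion_map I) (points \<Gamma>) \<and>
    embedding_map (uniform_topology (points \<Gamma>) \<U>) (completion_topology \<Gamma> I) (completion_map I) \<and>
    subgraph (completion_map I ` points \<Gamma>) (completion_graph \<Gamma> I) \<and>
    completion_topology \<Gamma> I closure_of (completion_map I ` points \<Gamma>)
      = points (completion_graph \<Gamma> I)"
proof -
  interpret cofinite_graph_system \<Gamma> \<U> I
    using assms by unfold_locales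
  show ?thesis
    using topological_graph_L compact_space_T[OF finite_points_quotient_graph] Hausdorff_space_T
      graph_map_completion_map inj_on_completion_map embedding_map_completion_map
      subgraph_image_graph_map[OF graph_\<Gamma> is_graph_L graph_map_completion_map]
      closure_of_completion_map_image
    by blast
qed

end
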